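(* Suppose the standing assumption in the context holds and the algorithm in the context does not terminate finitely. Let $x_*$ be a first-order KKT point for the problem $\min_{x\in\mathbb{R}^n} f(x)+r(x)$ subject to $c(x)=0$, $x\in\Omega$, with Lagrange multiplier vectors $y_*\in\mathbb{R}^m$ and $z_*\in\mathbb{R}^n$, $z_*\le0$, for the equality constraints and bound constraints, respectively. Suppose that strict complementarity holds, i.e., that $\max\{x_*,-z_*\}>0$ (componentwise). Let $\mathcal{S}_1\subseteq\mathcal{S}$ be an infinite index set such that $\{x_k\}_{k\in\mathcal{S}_1}\to x_*$, $\{s_k\}_{k\in\mathcal{S}_1}\to0$, and $\{z_k\}_{k\in\mathcal{S}_1}\to z_*$. Then $\mathcal{A}(x_{k+1})=\mathcal{A}(x_* )$ for all sufficiently large $k\in\mathcal{S}_1$, where $\mathcal{A}(x):=\{i:[x]_i=0\}$.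
   Context: Problem and notation. Consider $\min_{x\in\mathbb{R}^n} f(x)+r(x)$ subject to $c(x)=0$, $x\in\Omega$, where $f:\mathbb{R}^n\to\mathbb{R}$ and $c:\mathbb{R}^n\to\mathbb{R}^m$ ($m\le n$) are continuously differentiable, $r:\mathbb{R}^n\to[0,\infty)$ is convex (possibly nonsmooth), and $\Omega=\{x\in\mathbb{R}^n: x\ge0\}$. Let $g=\nabla f$ and $J(x)=\nabla c(x)^T\in\mathbb{R}^{m\times n}$ (the Jacobian); $f_k,r_k,g_k,c_k,J_k$ denote values at $x_k$; $\mathbb{N}=\{0,1,2,\dots\}$; minima/maxima of vectors are componentwise; $\mathrm{Proj}_C$ is Euclidean projection onto $C$; $T_\Omega(x)$ is the tangent cone of $\Omega$ at $x$. A point $x$ is a first-order KKT point with multipliers $(y,z)$ if there exists $g_r\in\partial r(x)$ with $g(x)+g_r+J(x)^Ty+z=0$, $c(x)=0$, $\min\{x,-z\}=0$. Algorithm. Inputs: $x_0\in\Omega$, $\alpha_0,\tau_{-1},\kappa_v>0$, and $\xi,\eta_\Phi,\sigma_c,\epsilon_\tau,\gamma,\eta_m\in(0,1)$. For $k=0,1,2,\dots$: (1) Let $\delta_k=\|\mathrm{Proj}_{T_\Omega(x_k)}(-J_k^Tc_k)\|_2$, $m_k(v)=\frac12\|c_k+J_kv\|_2^2$, and $v_k(\beta)=\mathrm{Proj}_\Omega(x_k-\beta J_k^Tc_k)-x_k$ for $\beta>0$. The Cauchy point is $v_k^c=v_k(\beta_k)$ with $\beta_k=\gamma^{i_k}$,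 where $i_k$ is the smallest nonnegative integer such that $\|v_k(\beta_k)\|_2\le\kappa_v\alpha_k\delta_k$ and $m_k(v_k(\beta_k))\le m_k(0)+\eta_m\nabla m_k(0)^Tv_k(\beta_k)$. (2) If $\delta_k=0$, set $v_k=0$ and, if additionally $c_k\ne0$, terminate returning $x_k$. If $\delta_k\neq0$, let $v_k$ be any vector with $\|v_k\|_2\le\kappa_v\alpha_k\delta_k$, $x_k+v_k\in\Omega$, and $m_k(v_k)\le m_k(v_k^c)$. (3) Let $u_k$ be the unique minimizer of $g_k^Tu+\frac{1}{2\alpha_k}\|u\|_2^2+\frac1{\alpha_k}v_k^Tu+r(x_k+v_k+u)$ over $u\in\mathbb{R}^n$ with $J_ku=0$, $x_k+v_k+u\in\Omega$; set $s_k=v_k+u_k$. Let $g_{r,k}\in\partial r(x_k+v_k+u_k)$, $y_k\in\mathbb{R}^m$, $z_k\in\mathbb{R}^n$ satisfy the optimality conditions $g_k+\frac1{\alpha_k}u_k+\frac1{\alpha_k}v_k+g_{r,k}+J_k^Ty_k+z_k=0$, $J_ku_k=0$, $\min\{x_k+v_k+u_k,-z_k\}=0$ (such quantities exist). (4) If $s_k=0$, terminate returning $x_k$. (5) Let $A_k=g_k^Ts_k+\frac1{2\alpha_k}\|s_k\|_2^2+r(x_k+s_k)-r_k$; $\tau_{k,\mathrm{trial}}=\infty$ if $A_k\le0$ and $\tau_{k,\mathrm{trial}}=(1-\sigma_c)(\|c_k\|_2-\|c_k+J_ks_k\|_2)/A_k$ otherwise; $\tau_k=\tau_{k-1}$ if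 $\tau_{k-1}\le\tau_{k,\mathrm{trial}}$ and $\tau_k=\min\{(1-\epsilon_\tau)\tau_{k-1},\tau_{k,\mathrm{trial}}\}$ otherwise. (6) With $\Phi_\tau(x)=\tau(f(x)+r(x))+\|c(x)\|_2$: if $\Phi_{\tau_k}(x_k+s_k)-\Phi_{\tau_k}(x_k)\le-\eta_\Phi\left(\frac{\tau_k}{4\alpha_k}\|s_k\|_2^2+\sigma_c(\|c_k\|_2-\|c_k+J_ks_k\|_2)\right)$, set $x_{k+1}=x_k+s_k$, $\alpha_{k+1}=\alpha_k$; otherwise set $x_{k+1}=x_k$, $\alpha_{k+1}=\xi\alpha_k$. $\mathcal{S}=\{k\in\mathbb{N}:x_{k+1}=x_k+s_k\}$ is the set of successful iterations. Standing assumption. There is an open convex set $\mathcal{X}\subseteq\mathbb{R}^n$ containing all $x_k$ and $x_k+v_k$ such that, over $\mathcal{X}$, $f$ and each $c_i$ are bounded, $\nabla f$ and each $\nabla c_i$ are Lipschitz continuous and bounded in norm, and $\partial r$ is bounded. *)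

theory Defs
  imports "HOL-Analysis.Analysis"
begin

text \<open>On \<^typ>\<open>real^'n\<close> the order \<open>\<le>\<close> and the lattice operations \<open>inf\<close> and \<open>sup\<close> are componentwise,
  so \<open>inf x (- z) = 0\<close> is the complementarity condition \<open>min{x, -z} = 0\<close>. The strict order
  \<open><\<close>, by contrast, is not componentwise on vectors.\<close>

definition gradient :: "(real^'n \<Rightarrow> real) \<Rightarrow> real^'n \<Rightarrow> real^'n" where
  "gradient f x = (THE D. GDERIV f x :> D)"

abbreviation Jac :: "(real^'n \<Rightarrow> real^'m) \<Rightarrow> real^'n \<Rightarrow> real^'n^'m" where
  "Jac c x \<equiv> jacobian c (at x)"

definition subdifferential :: "(real^'n \<Rightarrow> real) \<Rightarrow> real^'n \<Rightarrow> (real^'n) set" where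
  "subdifferential r x = {g. \<forall>y. r y \<ge> r x + g \<bullet> (y - x)}"

text \<open>The Bouligand tangent cone: limits of \<open>(w j - x) / t j\<close> with \<open>w j\<close> in the set,
  \<open>w j\<close> tending to \<open>x\<close> and \<open>t j\<close> tending to 0 through positive numbers.\<close>

definition tangent_cone :: "(real^'n) set \<Rightarrow> real^'n \<Rightarrow> (real^'n) set" where
  "tangent_cone C x =
    {d. \<exists>w t. (\<forall>j::nat. w j \<in> C \<and> t j > 0) \<and> w \<longlonglongrightarrow> x \<and> t \<longlonglongrightarrow> (0::real) \<and>
          (\<lambda>j. (w j - x) /\<^sub>R t j) \<longlonglongrightarrow> d}"

definition nonneg_orthant :: "(real^'n) set" where
  "nonneg_orthant = {x. 0 \<le> x}"

definition active_set :: "real^'n \<Rightarrow> 'n set" where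
  "active_set x = {i. x $ i = 0}"

definition kkt_point ::
  "(real^'n \<Rightarrow> real) \<Rightarrow> (real^'n \<Rightarrow> real^'m) \<Rightarrow> (real^'n \<Rightarrow> real) \<Rightarrow>
    real^'n \<Rightarrow> real^'m \<Rightarrow> real^'n \<Rightarrow> bool" where
  "kkt_point f c r x y z \<longleftrightarrow>
    (\<exists>gr \<in> subdifferential r x. gradient f x + gr + transpose (Jac c x) *v y + z = 0) \<and>
    c x = 0 \<and> inf x (- z) = 0"

locale composite_problem =
  fixes f :: "real^'n \<Rightarrow> real" and c :: "real^'n \<Rightarrow> real^'m" and r :: "real^'n \<Rightarrow> real"
  assumes dim: "CARD('m) \<le> CARD('n)"
    and f_differentiable: "f differentiable_on UNIV"
    and f_C1: "continuous_on UNIV (gradient f)"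
    and c_differentiable: "c differentiable_on UNIV"
    and c_C1: "continuous_on UNIV (Jac c)"
    and r_nonneg: "\<And>x. 0 \<le> r x"
    and r_convex: "convex_on UNIV r"

definition feas_stationarity :: "(real^'n \<Rightarrow> real^'m) \<Rightarrow> real^'n \<Rightarrow> real" where
  "feas_stationarity c x =
    norm (closest_point (tangent_cone nonneg_orthant x) (- (transpose (Jac c x) *v c x)))"

definition feas_model :: "(real^'n \<Rightarrow> real^'m) \<Rightarrow> real^'n \<Rightarrow> real^'n \<Rightarrow> real" where
  "feas_model c x v = 1/2 * (norm (c x + Jac c x *v v))\<^sup>2"

definition projected_step :: "(real^'n \<Rightarrow> real^'m) \<Rightarrow> real^'n \<Rightarrow> real \<Rightarrow> real^'n" where
  "projected_step c x \<beta> = closest_point nonneg_orthant (x - \<beta> *\<^sub>R (transpose (Jac c x) *v c x)) - x"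

definition cauchy_acceptable ::
  "(real^'n \<Rightarrow> real^'m) \<Rightarrow> real \<Rightarrow> real \<Rightarrow> real^'n \<Rightarrow> real \<Rightarrow> real \<Rightarrow> bool" where
  "cauchy_acceptable c \<kappa>v \<eta>m x \<alpha> \<beta> \<longleftrightarrow>
    norm (projected_step c x \<beta>) \<le> \<kappa>v * \<alpha> * feas_stationarity c x \<and>
    feas_model c x (projected_step c x \<beta>)
      \<le> feas_model c x 0 + \<eta>m * (gradient (feas_model c x) 0 \<bullet> projected_step c x \<beta>)"

definition cauchy_point ::
  "(real^'n \<Rightarrow> real^'m) \<Rightarrow> real \<Rightarrow> real \<Rightarrow> real \<Rightarrow> real^'n \<Rightarrow> real \<Rightarrow> real^'n" where
  "cauchy_point c \<kappa>v \<gamma> \<eta>m x \<alpha> =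
    projected_step c x (\<gamma> ^ (LEAST i. cauchy_acceptable c \<kappa>v \<eta>m x \<alpha> (\<gamma> ^ i)))"

definition tangential_objective ::
  "(real^'n \<Rightarrow> real) \<Rightarrow> (real^'n \<Rightarrow> real) \<Rightarrow> real^'n \<Rightarrow> real \<Rightarrow> real^'n \<Rightarrow> real^'n \<Rightarrow> real" where
  "tangential_objective f r x \<alpha> v u =
    gradient f x \<bullet> u + 1 / (2*\<alpha>) * (norm u)\<^sup>2 + 1 / \<alpha> * (v \<bullet> u) + r (x + v + u)"

definition tangential_feasible ::
  "(real^'n \<Rightarrow> real^'m) \<Rightarrow> real^'n \<Rightarrow> real^'n \<Rightarrow> real^'n \<Rightarrow> bool" where
  "tangential_feasible c x v u \<longleftrightarrow> Jac c x *v u = 0 \<and> x + v + u \<in> nonneg_orthant"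

definition linearized_reduction ::
  "(real^'n \<Rightarrow> real^'m) \<Rightarrow> real^'n \<Rightarrow> real^'n \<Rightarrow> real" where
  "linearized_reduction c x s = norm (c x) - norm (c x + Jac c x *v s)"

definition objective_change ::
  "(real^'n \<Rightarrow> real) \<Rightarrow> (real^'n \<Rightarrow> real) \<Rightarrow> real^'n \<Rightarrow> real \<Rightarrow> real^'n \<Rightarrow> real" where
  "objective_change f r x \<alpha> s = gradient f x \<bullet> s + 1 / (2*\<alpha>) * (norm s)\<^sup>2 + r (x + s) - r x"

definition \<tau>_trial ::
  "(real^'n \<Rightarrow> real) \<Rightarrow> (real^'n \<Rightarrow> real^'m) \<Rightarrow> (real^'n \<Rightarrow> real) \<Rightarrow> real \<Rightarrow>
    real^'n \<Rightarrow> real \<Rightarrow> real^'n \<Rightarrow> ereal" where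
  "\<tau>_trial f c r \<sigma>c x \<alpha> s =
    (if objective_change f r x \<alpha> s \<le> 0 then \<infinity>
     else ereal ((1 - \<sigma>c) * linearized_reduction c x s / objective_change f r x \<alpha> s))"

definition merit ::
  "(real^'n \<Rightarrow> real) \<Rightarrow> (real^'n \<Rightarrow> real^'m) \<Rightarrow> (real^'n \<Rightarrow> real) \<Rightarrow> real \<Rightarrow> real^'n \<Rightarrow> real" where
  "merit f c r \<tau> x = \<tau> * (f x + r x) + norm (c x)"

definition sufficient_decrease ::
  "(real^'n \<Rightarrow> real) \<Rightarrow> (real^'n \<Rightarrow> real^'m) \<Rightarrow> (real^'n \<Rightarrow> real) \<Rightarrow> real \<Rightarrow> real \<Rightarrow>
    real^'n \<Rightarrow> real \<Rightarrow> real \<Rightarrow> real^'n \<Rightarrow> bool" where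
  "sufficient_decrease f c r \<eta>\<Phi> \<sigma>c x \<alpha> \<tau> s \<longleftrightarrow>
    merit f c r \<tau> (x + s) - merit f c r \<tau> x
      \<le> - \<eta>\<Phi> * (\<tau> / (4*\<alpha>) * (norm s)\<^sup>2 + \<sigma>c * linearized_reduction c x s)"

text \<open>The data generated by a run of the algorithm that never terminates: both termination tests
  fail at every iteration. The sequence \<open>\<tau>\<close> starts at index 0; the input that precedes it
  (index -1 in the mathematics) is \<open>\<tau>init\<close>. The steps \<open>v\<close> and the triples \<open>(gr, y, z)\<close> are
  not determined by the algorithm, and any admissible choice is allowed.\<close>

locale infinite_run = composite_problem f c r
  for f :: "real^'n \<Rightarrow> real" and c :: "real^'n \<Rightarrow> real^'m" and r :: "real^'n \<Rightarrow> real" +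
  fixes x0 :: "real^'n" and \<alpha>0 \<tau>init \<kappa>v \<xi> \<eta>\<Phi> \<sigma>c \<epsilon>\<tau> \<gamma> \<eta>m :: real
    and x :: "nat \<Rightarrow> real^'n" and \<alpha> \<tau> :: "nat \<Rightarrow> real"
    and v u s gr :: "nat \<Rightarrow> real^'n" and y :: "nat \<Rightarrow> real^'m" and z :: "nat \<Rightarrow> real^'n"
  assumes x0: "x0 \<in> nonneg_orthant"
    and positive_inputs: "\<alpha>0 > 0" "\<tau>init > 0" "\<kappa>v > 0"
    and unit_inputs: "{\<xi>, \<eta>\<Phi>, \<sigma>c, \<epsilon>\<tau>, \<gamma>, \<eta>m} \<subseteq> {0<..<1}"
    and init: "x 0 = x0" "\<alpha> 0 = \<alpha>0"
    and normal_step_zero: "\<And>k. feas_stationarity c (x k) = 0 \<Longrightarrow> v k = 0"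
    and no_infeasible_termination: "\<And>k. \<not> (feas_stationarity c (x k) = 0 \<and> c (x k) \<noteq> 0)"
    and normal_step: "\<And>k. feas_stationarity c (x k) \<noteq> 0 \<Longrightarrow>
          norm (v k) \<le> \<kappa>v * \<alpha> k * feas_stationarity c (x k) \<and>
          x k + v k \<in> nonneg_orthant \<and>
          feas_model c (x k) (v k) \<le> feas_model c (x k) (cauchy_point c \<kappa>v \<gamma> \<eta>m (x k) (\<alpha> k))"
    and tangential_step: "\<And>k. is_arg_min (tangential_objective f r (x k) (\<alpha> k) (v k))
          (tangential_feasible c (x k) (v k)) (u k)"
    and full_step: "\<And>k. s k = v k + u k"
    and multipliers: "\<And>k. gr k \<in> subdifferential r (x k + v k + u k) \<and>
          gradient f (x k) + (1 / \<alpha> k) *\<^sub>R u k + (1 / \<alpha> k) *\<^sub>R v k + gr k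
            + transpose (Jac c (x k)) *v y k + z k = 0 \<and>
          Jac c (x k) *v u k = 0 \<and>
          inf (x k + v k + u k) (- z k) = 0"
    and no_zero_step_termination: "\<And>k. s k \<noteq> 0"
    and merit_parameter: "\<And>k. let \<tau>prev = (case k of 0 \<Rightarrow> \<tau>init | Suc j \<Rightarrow> \<tau> j);
              \<tau>tr = \<tau>_trial f c r \<sigma>c (x k) (\<alpha> k) (s k)
          in ereal (\<tau> k) =
              (if ereal \<tau>prev \<le> \<tau>tr then ereal \<tau>prev
               else min (ereal ((1 - \<epsilon>\<tau>) * \<tau>prev)) \<tau>tr)"
    and update: "\<And>k. if sufficient_decrease f c r \<eta>\<Phi> \<sigma>c (x k) (\<alpha> k) (\<tau> k) (s k)
          then x (Suc k) = x k + s k \<and> \<alpha> (Suc k) = \<alpha> k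
          else x (Suc k) = x k \<and> \<alpha> (Suc k) = \<xi> * \<alpha> k"

definition successful :: "(nat \<Rightarrow> real^'n) \<Rightarrow> (nat \<Rightarrow> real^'n) \<Rightarrow> nat set" where
  "successful x s = {k. x (Suc k) = x k + s k}"

definition standing_assumption ::
  "(real^'n \<Rightarrow> real) \<Rightarrow> (real^'n \<Rightarrow> real^'m) \<Rightarrow> (real^'n \<Rightarrow> real) \<Rightarrow>
    (nat \<Rightarrow> real^'n) \<Rightarrow> (nat \<Rightarrow> real^'n) \<Rightarrow> bool" where
  "standing_assumption f c r x v \<longleftrightarrow>
    (\<exists>X. open X \<and> convex X \<and> (\<forall>k. x k \<in> X \<and> x k + v k \<in> X) \<and>
      bounded (f ` X) \<and> (\<exists>L. L-lipschitz_on X (gradient f)) \<and> bounded (gradient f ` X) \<and>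
      (\<forall>i. bounded ((\<lambda>w. c w $ i) ` X) \<and>
           (\<exists>L. L-lipschitz_on X (gradient (\<lambda>w. c w $ i))) \<and>
           bounded (gradient (\<lambda>w. c w $ i) ` X)) \<and>
      bounded (\<Union>w\<in>X. subdifferential r w))"

end

theory Submission
  imports Defs
begin

lemma inf_vec_zero_component:
  fixes a b :: "real^'n"
  assumes "inf a b = 0"
  shows "min (a $ i) (b $ i) = 0"
proof -
  have "min (a $ i) (b $ i) = inf a b $ i"
    by (simp add: inf_vec_def inf_min)
  with assms show ?thesis
    by simp
qed

text \<open>On each component, strict complementarity makes exactly one of \<open>x\<close> and \<open>- z\<close> positive. That
  one stays positive along the filter, so complementarity forces the same one of \<open>w k\<close>, \<open>- z k\<close>
  to be the zero entry.\<close>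

lemma eventually_active_set_eq:
  fixes w z :: "'a \<Rightarrow> real^'n" and x_star z_star :: "real^'n"
  assumes w: "(w \<longlongrightarrow> x_star) F" and z: "(z \<longlongrightarrow> z_star) F"
    and compl: "\<forall>\<^sub>F k in F. inf (w k) (- z k) = 0"
    and compl_star: "inf x_star (- z_star) = 0"
    and strict: "\<forall>i. sup x_star (- z_star) $ i > 0"
  shows "\<forall>\<^sub>F k in F. active_set (w k) = active_set x_star"
proof -
  have "\<forall>\<^sub>F k in F. w k $ i = 0 \<longleftrightarrow> x_star $ i = 0" for i
  proof (cases "x_star $ i = 0")
    case True
    \<comment> \<open>With \<open>x_star $ i = 0\<close>, the maximum in strict complementarity can
      be positive only through its second entry.\<close>
    with strict have "- z_star $ i > 0"
      by (simp add: sup_vec_def sup_max less_max_iff_disj) (metis less_irrefl)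
    hence "\<forall>\<^sub>F k in F. z k $ i < 0"
      by (intro order_tendstoD(2)[OF tendsto_vec_nth[OF z]]) simp
    with compl show ?thesis
    proof eventually_elim
      case (elim k)
      from inf_vec_zero_component[OF elim(1), of i] elim(2) True show ?case
        by (simp add: min_def split: if_splits)
    qed
  next
    case False
    \<comment> \<open>A zero minimum makes both entries nonnegative, so a nonzero
      \<open>x_star $ i\<close> is positive; convergence of \<open>w\<close> then makes both sides
      of the equivalence false eventually.\<close>
    with inf_vec_zero_component[OF compl_star, of i] have "x_star $ i > 0"
      by (simp add: min_def split: if_splits)
    hence "\<forall>\<^sub>F k in F. w k $ i > 0"
      by (intro order_tendstoD(1)[OF tendsto_vec_nth[OF w]])
    thus ?thesis
      using False by (auto elim: eventually_mono)
  qed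
  \<comment> \<open>The index type is finite, so one threshold serves all components.\<close>
  hence "\<forall>\<^sub>F k in F. \<forall>i. w k $ i = 0 \<longleftrightarrow> x_star $ i = 0"
    by (intro eventually_all_finite)
  thus ?thesis
    by eventually_elim (simp add: active_set_def)
qed

theorem theorem5p26:
  fixes f :: "real^'n \<Rightarrow> real" and c :: "real^'n \<Rightarrow> real^'m" and r :: "real^'n \<Rightarrow> real"
    and x0 :: "real^'n" and \<alpha>0 \<tau>init \<kappa>v \<xi> \<eta>\<Phi> \<sigma>c \<epsilon>\<tau> \<gamma> \<eta>m :: real
    and x :: "nat \<Rightarrow> real^'n" and \<alpha> \<tau> :: "nat \<Rightarrow> real"
    and v u s gr :: "nat \<Rightarrow> real^'n" and y :: "nat \<Rightarrow> real^'m" and z :: "nat \<Rightarrow> real^'n"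
    and x_star z_star :: "real^'n" and y_star :: "real^'m" and S1 :: "nat set"
  assumes "infinite_run f c r x0 \<alpha>0 \<tau>init \<kappa>v \<xi> \<eta>\<Phi> \<sigma>c \<epsilon>\<tau> \<gamma> \<eta>m x \<alpha> \<tau> v u s gr y z"
    and "standing_assumption f c r x v"
    and "kkt_point f c r x_star y_star z_star"
    and "z_star \<le> 0"
    and "\<forall>i. sup x_star (- z_star) $ i > 0"
    and "S1 \<subseteq> successful x s"
    and "infinite S1"
    and "(x \<longlongrightarrow> x_star) (inf sequentially (principal S1))"
    and "(s \<longlongrightarrow> 0) (inf sequentially (principal S1))"
    and "(z \<longlongrightarrow> z_star) (inf sequentially (principal S1))"
  shows "\<exists>K. \<forall>k\<in>S1. k \<ge> K \<longrightarrow> active_set (x (Suc k)) = active_set x_star"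
proof -
  interpret infinite_run f c r x0 \<alpha>0 \<tau>init \<kappa>v \<xi> \<eta>\<Phi> \<sigma>c \<epsilon>\<tau> \<gamma> \<eta>m x \<alpha> \<tau> v u s gr y z
    by (fact assms(1))
  let ?F = "inf sequentially (principal S1)"
  \<comment> \<open>The trial point \<open>x k + s k\<close> is where the subproblem pairs
    complementarity with \<open>z k\<close>; vanishing steps give it the limit of
    \<open>x k\<close>. The filter \<open>?F\<close> expresses k tending to infinity within
    \<open>S1\<close>.\<close>
  have "((\<lambda>k. x k + s k) \<longlongrightarrow> x_star) ?F"
    using tendsto_add[OF assms(8,9)] by simp
  moreover have "\<forall>\<^sub>F k in ?F. inf (x k + s k) (- z k) = 0"
    using multipliers by (simp add: full_step add.assoc)
  moreover have "inf x_star (- z_star) = 0"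
    using assms(3) by (simp add: kkt_point_def)
  ultimately have "\<forall>\<^sub>F k in ?F. active_set (x k + s k) = active_set x_star"
    using assms(5,10) by (intro eventually_active_set_eq)
  then obtain K where "\<forall>k\<ge>K. k \<in> S1 \<longrightarrow> active_set (x k + s k) = active_set x_star"
    by (auto simp: eventually_inf_principal eventually_sequentially)
  \<comment> \<open>Success of the iterations in \<open>S1\<close> turns the trial point into the
    next iterate.\<close>
  moreover have "x (Suc k) = x k + s k" if "k \<in> S1" for k
    using that assms(6) by (auto simp: successful_def)
  ultimately show ?thesis
    by auto
qed

end
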